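(* Let $(X,f)$ be a Deaconu--Renault system with $X$ a metric space with metric $d$, such that $\operatorname{Dom}(f)$ admits a tame defining sequence $\{\mathcal U_n\}_{n\in\mathbb N}$ (with respect to the restriction of $d$). Then the following statements are equivalent: (M) (Metric shadowing) For every $\varepsilon>0$ there exists $\delta>0$ such that every $\delta$-pseudo-orbit in $\operatorname{Dom}(f)$ is $\varepsilon$-shadowed by some $z\in\operatorname{Dom}(f)$. (T) (Shadowing via the defining sequence) For every $n\in\mathbb N$ there exists $m\ge n$ such that every $\mathcal U_m$-pseudo-orbit is $\mathcal U_n$-shadowed by some $z\in\operatorname{Dom}(f)$.
   Context: A Deaconu--Renault system is a pair $(X,f)$ where $X$ is a locally compact Hausdorff space and $f:\operatorname{Dom}(f)\to\operatorname{Im}(f)$ is a local homeomorphism (onto $\operatorname{Im}(f)$), with $\operatorname{Dom}(f),\operatorname{Im}(f)$ open subsets of $X$. A partition of a space $Y$ is a countable family of pairwise disjoint, nonempty, clopen subsets of $Y$ whose union is $Y$. A defining sequence of $Y$ is a sequence $\{\mathcal U_n\}_{n\in\mathbb N}$ of partitions of $Y$ such that (1) $\mathcal U_{n+1}$ refines $\mathcal U_n$ (each element of $\mathcal U_{n+1}$ is contained in an element of $\mathcal U_n$), and (2) $\{U: U\in\mathcal U_n\text{ for some }n\}$ is a basis for the topology of $Y$. If $Y$ is a metric space with metric $d$, a defining sequence is tame if $S_n:=\sup\{\operatorname{diam}(O):O\in\mathcal U_n\}\to0$ as $n\to\infty$ and for each $n$ there is $\rho_n>0$ such that $d(x_1,x_2)\ge\rho_n$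 whenever $x_1\in O_1$, $x_2\in O_2$ with $O_1\neq O_2$ in $\mathcal U_n$. A $\delta$-pseudo-orbit is a sequence $(x_i)$ in $\operatorname{Dom}(f)$, indexed by $i\geq 0$, with $d(f(x_i),x_{i+1})<\delta$ for all $i$. A point $z$ $\varepsilon$-shadows $(x_i)$ if $z\in\operatorname{Dom}(f^i)$ and $d(f^i(z),x_i)<\varepsilon$ for all $i$. For a partition $\mathcal U$ of $\operatorname{Dom}(f)$ into clopen sets: a sequence $(x_i)\subseteq\operatorname{Dom}(f)$ is a $\mathcal U$-pseudo-orbit if for every $i$ there is $U_i\in\mathcal U$ with $\{f(x_i),x_{i+1}\}\subseteq U_i$; a point $z\in\operatorname{Dom}(f)$ $\mathcal U$-shadows $(x_i)$ if for every $i$ there is $W_i\in\mathcal U$ with $\{f^i(z),x_i\}\subseteq W_i$ (in particular $f^i(z)$ is defined).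
   Formalization: In (M), only δ-pseudo-orbits whose images f(x_i) also lie in Dom(f) are required to be shadowed; without this condition (T) does not imply (M). *)

theory Defs
  imports "HOL-Analysis.Analysis"
begin

text \<open>
  A partial map on the space \<open>X\<close> (the whole type) is a total function \<open>f\<close> together with its domain
  \<open>D\<close>; the values of \<open>f\<close> outside \<open>D\<close> are junk.
\<close>

definition local_homeo_on :: "'a::topological_space set \<Rightarrow> ('a \<Rightarrow> 'a) \<Rightarrow> bool" where
  "local_homeo_on D f \<longleftrightarrow>
     (\<forall>x\<in>D. \<exists>U g. openin (top_of_set D) U \<and> x \<in> U \<and>
        openin (top_of_set (f ` D)) (f ` U) \<and> homeomorphism U (f ` U) f g)"

definition deaconu_renault :: "'a::t2_space set \<Rightarrow> ('a \<Rightarrow> 'a) \<Rightarrow> bool" where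
  "deaconu_renault D f \<longleftrightarrow>
     locally_compact_space (euclidean :: 'a topology) \<and>
     open D \<and> open (f ` D) \<and> local_homeo_on D f"

text \<open>\<open>Dom(f^n)\<close>; in particular \<open>Dom(f^0)\<close> is the whole space and \<open>Dom(f^1) = D\<close>.\<close>

definition dom_pow :: "'a set \<Rightarrow> ('a \<Rightarrow> 'a) \<Rightarrow> nat \<Rightarrow> 'a set" where
  "dom_pow D f n = {z. \<forall>j<n. (f ^^ j) z \<in> D}"

definition clopen_partition :: "'a topology \<Rightarrow> 'a set set \<Rightarrow> bool" where
  "clopen_partition Y \<U> \<longleftrightarrow>
     countable \<U> \<and> disjoint \<U> \<and>
     (\<forall>U\<in>\<U>. U \<noteq> {} \<and> openin Y U \<and> closedin Y U) \<and>
     \<Union>\<U> = topspace Y"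

definition basis_of :: "'a topology \<Rightarrow> 'a set set \<Rightarrow> bool" where
  "basis_of Y \<B> \<longleftrightarrow>
     (\<forall>B\<in>\<B>. openin Y B) \<and> (\<forall>V. openin Y V \<longrightarrow> (\<exists>\<C>\<subseteq>\<B>. \<Union>\<C> = V))"

definition defining_sequence :: "'a topology \<Rightarrow> (nat \<Rightarrow> 'a set set) \<Rightarrow> bool" where
  "defining_sequence Y \<U> \<longleftrightarrow>
     (\<forall>n. clopen_partition Y (\<U> n)) \<and>
     (\<forall>n. \<forall>V\<in>\<U> (Suc n). \<exists>U\<in>\<U> n. V \<subseteq> U) \<and>
     basis_of Y (\<Union>n. \<U> n)"

text \<open>
  The diameter is taken with values in \<open>[0, \<infinity>]\<close>: the real-valued \<^const>\<open>diameter\<close> has no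
  meaningful value on unbounded sets. The supremum over an empty partition is \<open>0\<close>.
\<close>

definition ediam :: "'a::metric_space set \<Rightarrow> ennreal" where
  "ediam S = (SUP x\<in>S. SUP y\<in>S. ennreal (dist x y))"

definition tame :: "(nat \<Rightarrow> 'a::metric_space set set) \<Rightarrow> bool" where
  "tame \<U> \<longleftrightarrow>
     (\<lambda>n. SUP O'\<in>\<U> n. ediam O') \<longlonglongrightarrow> 0 \<and>
     (\<forall>n. \<exists>\<rho>>0. \<forall>O1\<in>\<U> n. \<forall>O2\<in>\<U> n. O1 \<noteq> O2 \<longrightarrow>
        (\<forall>x1\<in>O1. \<forall>x2\<in>O2. dist x1 x2 \<ge> \<rho>))"

text \<open>
  Here \<open>f (x i)\<close> may lie outside \<open>D\<close>, at a small distance from \<open>x (Suc i)\<close>. Metric shadowing is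
  considered for pseudo-orbits in \<open>D\<close>, meaning that the images \<open>f (x i)\<close> also lie in \<open>D\<close>. Without
  this, metric shadowing is not equivalent to shadowing via a tame defining sequence: take the
  discrete space of points \<open>a n = (n, 1)\<close>, \<open>b n = (n, 0)\<close>, \<open>c n = (n, 1 / (2 * n))\<close> of the plane,
  \<open>n \<ge> 1\<close>, with \<open>D\<close> the set of all \<open>a n\<close> and \<open>b n\<close>, \<open>f (a n) = c n\<close>, \<open>f (b n) = b n\<close>, and all
  partitions equal to the partition into singletons. Then \<open>a n, b n, b n, \<dots>\<close> is a
  \<open>\<delta>\<close>-pseudo-orbit for large \<open>n\<close> which is not \<open>1/2\<close>-shadowed.
\<close>

definition pseudo_orbit :: "'a::metric_space set \<Rightarrow> ('a \<Rightarrow> 'a) \<Rightarrow> real \<Rightarrow> (nat \<Rightarrow> 'a) \<Rightarrow> bool" where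
  "pseudo_orbit D f \<delta> x \<longleftrightarrow> (\<forall>i. x i \<in> D \<and> dist (f (x i)) (x (Suc i)) < \<delta>)"

definition shadows ::
  "'a::metric_space set \<Rightarrow> ('a \<Rightarrow> 'a) \<Rightarrow> real \<Rightarrow> 'a \<Rightarrow> (nat \<Rightarrow> 'a) \<Rightarrow> bool" where
  "shadows D f \<epsilon> z x \<longleftrightarrow> (\<forall>i. z \<in> dom_pow D f i \<and> dist ((f ^^ i) z) (x i) < \<epsilon>)"

definition partition_pseudo_orbit ::
  "'a set \<Rightarrow> ('a \<Rightarrow> 'a) \<Rightarrow> 'a set set \<Rightarrow> (nat \<Rightarrow> 'a) \<Rightarrow> bool" where
  "partition_pseudo_orbit D f \<U> x \<longleftrightarrow>
     (\<forall>i. x i \<in> D \<and> (\<exists>U\<in>\<U>. {f (x i), x (Suc i)} \<subseteq> U))"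

definition partition_shadows ::
  "'a set \<Rightarrow> ('a \<Rightarrow> 'a) \<Rightarrow> 'a set set \<Rightarrow> 'a \<Rightarrow> (nat \<Rightarrow> 'a) \<Rightarrow> bool" where
  "partition_shadows D f \<U> z x \<longleftrightarrow>
     z \<in> D \<and> (\<forall>i. z \<in> dom_pow D f i \<and> (\<exists>W\<in>\<U>. {(f ^^ i) z, x i} \<subseteq> W))"

end

theory Submission
  imports Defs
begin

text \<open>
  Both notions of closeness define the same uniformity on \<open>D\<close>: elements of late partitions have small
  diameter, and points closer than the separation constant of a partition lie in a common element.
  Each direction replaces the pseudo-orbit and the shadowing condition accordingly; metric shadowing
  by \<open>z\<close> keeps the whole orbit of \<open>z\<close> in \<open>D\<close>, so that the separation constant applies to it.
\<close>

lemma dist_le_ediam: "x \<in> S \<Longrightarrow> y \<in> S \<Longrightarrow> ennreal (dist x y) \<le> ediam S"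
  unfolding ediam_def by (rule order_trans[OF SUP_upper[of y S] SUP_upper[of x S]])

lemma tame_mesh:
  assumes "tame \<U>" "\<epsilon> > 0"
  obtains m where "m \<ge> n" "\<forall>U\<in>\<U> m. \<forall>x\<in>U. \<forall>y\<in>U. dist x y < \<epsilon>"
proof -
  have "\<forall>\<^sub>F m in sequentially. (SUP U\<in>\<U> m. ediam U) < ennreal \<epsilon>"
    using assms by (intro order_tendstoD(2)[where y = 0]) (auto simp: tame_def)
  then have "\<forall>\<^sub>F m in sequentially. m \<ge> n \<and> (SUP U\<in>\<U> m. ediam U) < ennreal \<epsilon>"
    by (intro eventually_conj eventually_ge_at_top)
  then obtain m where m: "m \<ge> n" "(SUP U\<in>\<U> m. ediam U) < ennreal \<epsilon>"
    using eventually_happens'[OF sequentially_bot] by blast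
  have "dist x y < \<epsilon>" if "U \<in> \<U> m" "x \<in> U" "y \<in> U" for U x y
  proof -
    have "ennreal (dist x y) \<le> (SUP U\<in>\<U> m. ediam U)"
      using dist_le_ediam[OF that(2,3)] SUP_upper[OF that(1), of ediam] by (rule order_trans)
    then have "ennreal (dist x y) < ennreal \<epsilon>"
      using m(2) by (rule le_less_trans)
    then show ?thesis
      by (simp add: ennreal_less_iff)
  qed
  with m(1) show thesis
    by (intro that) auto
qed

lemma tame_separation:
  assumes "tame \<U>" "\<Union>(\<U> n) = D"
  obtains \<rho> where "\<rho> > 0"
    "\<forall>x\<in>D. \<forall>y\<in>D. dist x y < \<rho> \<longrightarrow> (\<exists>U\<in>\<U> n. {x, y} \<subseteq> U)"
proof -
  obtain \<rho> where \<rho>: "\<rho> > 0"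
    "\<And>U V x y. U \<in> \<U> n \<Longrightarrow> V \<in> \<U> n \<Longrightarrow> U \<noteq> V \<Longrightarrow> x \<in> U \<Longrightarrow> y \<in> V \<Longrightarrow> \<rho> \<le> dist x y"
    using assms(1) unfolding tame_def by metis
  have "\<exists>U\<in>\<U> n. {x, y} \<subseteq> U" if xy: "x \<in> D" "y \<in> D" "dist x y < \<rho>" for x y
  proof -
    obtain U V where UV: "U \<in> \<U> n" "V \<in> \<U> n" "x \<in> U" "y \<in> V"
      using xy(1,2) assms(2) by blast
    then have "U = V"
      using \<rho>(2)[of U V x y] xy(3) by force
    with UV show ?thesis by blast
  qed
  with \<rho>(1) show thesis
    by (intro that) auto
qed

lemma dom_pow_all_iff: "(\<forall>i. z \<in> dom_pow D f i) \<longleftrightarrow> (\<forall>i. (f ^^ i) z \<in> D)"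
  unfolding dom_pow_def by blast

theorem proposition4p6:
  fixes D :: "'a::metric_space set" and f :: "'a \<Rightarrow> 'a" and \<U> :: "nat \<Rightarrow> 'a set set"
  assumes "deaconu_renault D f"
    and "defining_sequence (top_of_set D) \<U>"
    and "tame \<U>"
  shows "(\<forall>\<epsilon>>0. \<exists>\<delta>>0. \<forall>x. pseudo_orbit D f \<delta> x \<and> (\<forall>i. f (x i) \<in> D) \<longrightarrow>
             (\<exists>z\<in>D. shadows D f \<epsilon> z x))
         \<longleftrightarrow>
         (\<forall>n. \<exists>m\<ge>n. \<forall>x. partition_pseudo_orbit D f (\<U> m) x \<longrightarrow>
             (\<exists>z\<in>D. partition_shadows D f (\<U> n) z x))"
  (is "?M \<longleftrightarrow> ?T")
proof -
  have cover: "\<Union>(\<U> n) = D" for n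
    using assms(2) unfolding defining_sequence_def clopen_partition_def by simp
  show ?thesis
  proof
    assume M: ?M
    show ?T
    proof
      fix n
      obtain \<rho> where \<rho>: "\<rho> > 0"
        "\<forall>x\<in>D. \<forall>y\<in>D. dist x y < \<rho> \<longrightarrow> (\<exists>U\<in>\<U> n. {x, y} \<subseteq> U)"
        by (rule tame_separation[OF assms(3) cover[of n]])
      obtain \<delta> where \<delta>: "\<delta> > 0"
        "\<forall>x. pseudo_orbit D f \<delta> x \<and> (\<forall>i. f (x i) \<in> D) \<longrightarrow> (\<exists>z\<in>D. shadows D f \<rho> z x)"
        using M \<rho>(1) by meson
      obtain m where m: "m \<ge> n" "\<forall>U\<in>\<U> m. \<forall>x\<in>U. \<forall>y\<in>U. dist x y < \<delta>"
        by (rule tame_mesh[OF assms(3) \<delta>(1)])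
      have "\<exists>z\<in>D. partition_shadows D f (\<U> n) z x"
        if x: "partition_pseudo_orbit D f (\<U> m) x" for x
      proof -
        have "pseudo_orbit D f \<delta> x"
          using x unfolding pseudo_orbit_def partition_pseudo_orbit_def by (meson m(2) insert_subset)
        moreover have "\<forall>i. f (x i) \<in> D"
          using x cover[of m] unfolding partition_pseudo_orbit_def by blast
        ultimately obtain z where z: "z \<in> D" "shadows D f \<rho> z x"
          using \<delta>(2) by blast
        then have "(f ^^ i) z \<in> D" for i
          using dom_pow_all_iff unfolding shadows_def by metis
        then have "partition_shadows D f (\<U> n) z x"
          using x z \<rho>(2) unfolding partition_shadows_def shadows_def partition_pseudo_orbit_def
          by simp
        with z(1) show ?thesis by blast
      qed
      with m(1) show "\<exists>m\<ge>n. \<forall>x. partition_pseudo_orbit D f (\<U> m) x \<longrightarrow>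
          (\<exists>z\<in>D. partition_shadows D f (\<U> n) z x)"
        by blast
    qed
  next
    assume T: ?T
    show ?M
    proof (intro allI impI)
      fix \<epsilon> :: real
      assume "\<epsilon> > 0"
      then obtain n where n: "\<forall>U\<in>\<U> n. \<forall>x\<in>U. \<forall>y\<in>U. dist x y < \<epsilon>"
        by (rule tame_mesh[OF assms(3)])
      obtain m where m: "\<forall>x. partition_pseudo_orbit D f (\<U> m) x \<longrightarrow>
          (\<exists>z\<in>D. partition_shadows D f (\<U> n) z x)"
        using T by meson
      obtain \<rho> where \<rho>: "\<rho> > 0"
        "\<forall>x\<in>D. \<forall>y\<in>D. dist x y < \<rho> \<longrightarrow> (\<exists>U\<in>\<U> m. {x, y} \<subseteq> U)"
        by (rule tame_separation[OF assms(3) cover[of m]])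
      have "\<exists>z\<in>D. shadows D f \<epsilon> z x"
        if "pseudo_orbit D f \<rho> x" "\<forall>i. f (x i) \<in> D" for x
      proof -
        have "partition_pseudo_orbit D f (\<U> m) x"
          using that \<rho>(2) unfolding pseudo_orbit_def partition_pseudo_orbit_def by simp
        then obtain z where z: "z \<in> D" "partition_shadows D f (\<U> n) z x"
          using m by blast
        then have "shadows D f \<epsilon> z x"
          unfolding partition_shadows_def shadows_def by (meson n insert_subset)
        with z(1) show ?thesis by blast
      qed
      with \<rho>(1) show "\<exists>\<delta>>0. \<forall>x. pseudo_orbit D f \<delta> x \<and> (\<forall>i. f (x i) \<in> D) \<longrightarrow>
          (\<exists>z\<in>D. shadows D f \<epsilon> z x)"
        by blast
    qed
  qed
qed

end
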